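(* Let $n\ge 2$ and let $b,b_2,\dots,b_n\in\mathbb{R}$. Let $\mathbf{S}_n(b,b_n)$ be the $n\times n$ discrete Schrödinger matrix with diagonal entries $b,b_2,\dots,b_n$ (in this order), and let $\mathbf{F}_n(b,0)$ be the $n\times n$ discrete Schrödinger matrix with diagonal entries $b,0,\dots,0$. Suppose $\mathbf{S}_n(b,b_n)$ shares all of its eigenvalues with $\mathbf{F}_n(b,0)$, i.e. the two matrices have the same spectrum. Then $\mathbf{S}_n(b,b_n)=\mathbf{F}_n(b,0)$, i.e. $b_2=\cdots=b_n=0$.
   Context: The $n\times n$ discrete Schrödinger matrix with real diagonal entries $d_1,\dots,d_n$ is the real symmetric tridiagonal matrix whose $(k,k)$ entry is $d_k$ for $1\le k\le n$, whose $(k,k+1)$ and $(k+1,k)$ entries equal $1$ for $1\le k\le n-1$, and whose other entries are all $0$. All eigenvalues of such matrices are real and simple. The same real number $b$ appears as the first diagonal entry of both matrices. *)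

theory Defs
  imports Jordan_Normal_Form.Spectral_Radius
begin

text \<open>
  The diagonal entries \<open>d 1, \<dots>, d n\<close> are numbered from 1, whereas the rows and columns
  of \<^typ>\<open>real mat\<close> are numbered from 0; hence the shift in \<open>d (i + 1)\<close>.
\<close>

definition schroedinger_mat :: "nat \<Rightarrow> (nat \<Rightarrow> real) \<Rightarrow> real mat" where
  "schroedinger_mat n d = mat n n (\<lambda>(i, j).
     if i = j then d (i + 1)
     else if j = i + 1 \<or> i = j + 1 then 1
     else 0)"

text \<open>Only the values \<open>bs 2, \<dots>, bs n\<close> of the argument \<open>bs\<close> are used.\<close>

definition S_mat :: "nat \<Rightarrow> real \<Rightarrow> (nat \<Rightarrow> real) \<Rightarrow> real mat" where
  "S_mat n b bs = schroedinger_mat n (\<lambda>k. if k = 1 then b else bs k)"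

definition F_mat :: "nat \<Rightarrow> real \<Rightarrow> real mat" where
  "F_mat n b = schroedinger_mat n (\<lambda>k. if k = 1 then b else 0)"

end

theory Submission imports Defs begin

text \<open>
  The eigenvalues of the matrix with diagonal \<open>d\<close> are the roots of the polynomial \<open>p\<^sub>n\<close> given by
  the three-term recurrence. The Christoffel--Darboux identity, applied to \<open>(z, cnj z)\<close> and
  confluently to \<open>(z, z)\<close>, shows that all complex roots of \<open>p\<^sub>n\<close> are real and simple, so the
  spectrum determines \<open>p\<^sub>n\<close>. Its coefficients at \<open>x\<^sup>n\<^sup>-\<^sup>1\<close> and \<open>x\<^sup>n\<^sup>-\<^sup>2\<close> determine \<open>\<Sum> d\<^sub>k\<close> and
  \<open>\<Sum> d\<^sub>k\<^sup>2\<close>. Comparing sums of squares for the two matrices gives \<open>\<Sum> b\<^sub>k\<^sup>2 = 0\<close>.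
\<close>

text \<open>Characteristic polynomial of the leading \<open>k\<close> by \<open>k\<close> block, by
  expansion along the last row. The ring is generic because real values meet the spectrum while
  complex ones are needed for factorization.\<close>

fun jacobi_poly :: "(nat \<Rightarrow> 'a::comm_ring_1) \<Rightarrow> nat \<Rightarrow> 'a poly" where
  "jacobi_poly d 0 = 1"
| "jacobi_poly d (Suc 0) = [:- d 1, 1:]"
| "jacobi_poly d (Suc (Suc k)) =
     [:- d (Suc (Suc k)), 1:] * jacobi_poly d (Suc k) - jacobi_poly d k"

lemma schroedinger_mat_carrier: "schroedinger_mat n d \<in> carrier_mat n n"
  by (simp add: schroedinger_mat_def)

lemma schroedinger_mat_mult_vec:
  assumes v: "v \<in> carrier_vec n" and i: "i < n"
  shows "(schroedinger_mat n d *\<^sub>v v) $ i =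
    d (Suc i) * v $ i + (if Suc i < n then v $ Suc i else 0) + (if 0 < i then v $ (i - 1) else 0)"
proof -
  have "(schroedinger_mat n d *\<^sub>v v) $ i = (\<Sum>j<n. schroedinger_mat n d $$ (i, j) * v $ j)"
    using v i schroedinger_mat_carrier[of n d]
    by (auto simp: scalar_prod_def atLeast0LessThan intro!: sum.cong)
  also have "\<dots> = (\<Sum>j<n. (if j = i then d (Suc i) * v $ i else 0)
      + (if j = Suc i then v $ Suc i else 0)
      + (if j = i - 1 then (if 0 < i then v $ (i - 1) else 0) else 0))"
    using i by (intro sum.cong refl) (auto simp: schroedinger_mat_def)
  also have "\<dots> = d (Suc i) * v $ i + (if Suc i < n then v $ Suc i else 0)
      + (if 0 < i then v $ (i - 1) else 0)"
    using i by (simp add: sum.distrib sum.delta)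
  finally show ?thesis .
qed

text \<open>Each row of the eigenvalue equation fixes the next entry from the two before it. Padding
  with 0 at index \<open>n\<close> lets the last row follow the same recurrence; the case
  \<open>k = n\<close> is then the root condition.\<close>

lemma eigenvector_schroedinger_mat_nth:
  assumes v: "v \<in> carrier_vec n" and ev: "schroedinger_mat n d *\<^sub>v v = x \<cdot>\<^sub>v v"
    and n: "0 < n" and k: "k \<le> n"
  shows "(if k < n then v $ k else 0) = v $ 0 * poly (jacobi_poly d k) x"
proof -
  define w where "w k = (if k < n then v $ k else 0)" for k
  have row: "w (Suc i) = (x - d (Suc i)) * w i - (if 0 < i then w (i - 1) else 0)" if "i < n" for i
    using schroedinger_mat_mult_vec[OF v that, of d] that v
    unfolding ev w_def by (auto simp: algebra_simps)
  have "w k = v $ 0 * poly (jacobi_poly d k) x" using k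
  proof (induction k rule: induct_nat_012)
    case 0
    then show ?case using n by (simp add: w_def)
  next
    case 1
    then show ?case using n row[of 0] by (simp add: w_def algebra_simps)
  next
    case (ge2 k)
    then show ?case using row[of "Suc k"] by (simp add: algebra_simps)
  qed
  then show ?thesis using k by (simp add: w_def)
qed

lemma eigenvalue_schroedinger_mat_iff:
  assumes n: "0 < n"
  shows "eigenvalue (schroedinger_mat n d) x \<longleftrightarrow> poly (jacobi_poly d n) x = 0"
proof
  assume "eigenvalue (schroedinger_mat n d) x"
  then obtain v where v: "v \<in> carrier_vec n" "v \<noteq> 0\<^sub>v n"
    and ev: "schroedinger_mat n d *\<^sub>v v = x \<cdot>\<^sub>v v"
    using schroedinger_mat_carrier[of n d] by (auto simp: eigenvalue_def eigenvector_def)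
  note nth = eigenvector_schroedinger_mat_nth[OF v(1) ev n]
  have "v $ 0 \<noteq> 0"
  proof
    assume "v $ 0 = 0"
    then have "v $ k = 0" if "k < n" for k
      using nth[of k] that by simp
    then have "v = 0\<^sub>v n" using v(1) by (intro eq_vecI) auto
    with v(2) show False ..
  qed
  then show "poly (jacobi_poly d n) x = 0" using nth[of n] by simp
next
  assume root: "poly (jacobi_poly d n) x = 0"
  \<comment> \<open>Up to scaling this is the only candidate: the eigenvector with first entry
    1.\<close>
  define v where "v = vec n (\<lambda>k. poly (jacobi_poly d k) x)"
  have v: "v \<in> carrier_vec n" by (simp add: v_def)
  have "v $ 0 \<noteq> 0\<^sub>v n $ 0" using n by (simp add: v_def)
  then have nz: "v \<noteq> 0\<^sub>v n" by metis
  have "schroedinger_mat n d *\<^sub>v v = x \<cdot>\<^sub>v v"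
  proof (rule eq_vecI)
    fix i assume "i < dim_vec (x \<cdot>\<^sub>v v)"
    then have i: "i < n" by (simp add: v_def)
    \<comment> \<open>In the last row the missing right neighbour may be replaced by the polynomial
      value at \<open>n\<close>, which is 0 by \<open>root\<close>.\<close>
    have next_zero: "(if Suc i < n then v $ Suc i else 0) = poly (jacobi_poly d (Suc i)) x"
      using root i by (cases "Suc i = n") (auto simp: v_def)
    show "(schroedinger_mat n d *\<^sub>v v) $ i = (x \<cdot>\<^sub>v v) $ i"
      unfolding schroedinger_mat_mult_vec[OF v i] next_zero
      using i by (cases i) (auto simp: v_def algebra_simps)
  qed (simp_all add: v_def schroedinger_mat_def)
  with v nz show "eigenvalue (schroedinger_mat n d) x"
    using schroedinger_mat_carrier[of n d] by (auto simp: eigenvalue_def eigenvector_def)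
qed

text \<open>Under the recurrence the terms with \<open>d\<close> cancel in the right side, so each
  induction step adds \<open>(x - y)\<close> times the new summand.\<close>

lemma christoffel_darboux:
  "(x - y) * (\<Sum>k\<le>n. poly (jacobi_poly d k) x * poly (jacobi_poly d k) y) =
     poly (jacobi_poly d (Suc n)) x * poly (jacobi_poly d n) y
     - poly (jacobi_poly d n) x * poly (jacobi_poly d (Suc n)) y"
  by (induction n) (simp_all add: algebra_simps)

lemma christoffel_darboux_confluent:
  fixes d :: "nat \<Rightarrow> 'a::idom"
  shows "(\<Sum>k\<le>n. (poly (jacobi_poly d k) x)\<^sup>2) =
     poly (pderiv (jacobi_poly d (Suc n))) x * poly (jacobi_poly d n) x
     - poly (pderiv (jacobi_poly d n)) x * poly (jacobi_poly d (Suc n)) x"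
proof (induction n)
  case (Suc n)
  have deriv_step: "poly (pderiv (jacobi_poly d (Suc (Suc n)))) x =
      poly (jacobi_poly d (Suc n)) x
      + (x - d (Suc (Suc n))) * poly (pderiv (jacobi_poly d (Suc n))) x
      - poly (pderiv (jacobi_poly d n)) x"
    unfolding jacobi_poly.simps(3) pderiv_diff pderiv_mult
    by (simp add: pderiv_pCons algebra_simps del: jacobi_poly.simps)
  have step: "poly (jacobi_poly d (Suc (Suc n))) x =
      (x - d (Suc (Suc n))) * poly (jacobi_poly d (Suc n)) x - poly (jacobi_poly d n) x"
    by (simp add: algebra_simps)
  show ?case
    unfolding sum.atMost_Suc Suc deriv_step step by (simp add: algebra_simps power2_eq_square del: jacobi_poly.simps)
qed (simp add: pderiv_pCons)

lemma jacobi_poly_monic: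
  fixes d :: "nat \<Rightarrow> 'a::idom"
  shows "degree (jacobi_poly d n) = n \<and> coeff (jacobi_poly d n) n = 1"
proof (induction n rule: induct_nat_012)
  case (ge2 n)
  have c: "coeff (jacobi_poly d (Suc (Suc n))) (Suc (Suc n)) = 1"
    using ge2 by (simp add: coeff_eq_0)
  have "degree (jacobi_poly d (Suc (Suc n))) \<le> Suc (Suc n)"
  proof (rule degree_le, intro allI impI)
    fix i assume "Suc (Suc n) < i"
    with ge2 show "coeff (jacobi_poly d (Suc (Suc n))) i = 0"
      by (cases i) (simp_all add: coeff_eq_0)
  qed
  with c show ?case by (metis le_antisym le_degree zero_neq_one)
qed auto

lemma coeff_jacobi_poly_1:
  fixes d :: "nat \<Rightarrow> 'a::idom"
  shows "coeff (jacobi_poly d (Suc n)) n = - (\<Sum>k=1..Suc n. d k)"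
proof (induction n)
  case (Suc n)
  then show ?case
    using jacobi_poly_monic[of d "Suc n"] jacobi_poly_monic[of d n]
    by (simp add: coeff_eq_0 algebra_simps)
qed simp

text \<open>The coefficient is the second elementary symmetric function of the diagonal minus 1 for
  each of the \<open>Suc n\<close> adjacent index pairs; doubling it brings in the power sums
  without division.\<close>

lemma coeff_jacobi_poly_2:
  fixes d :: "nat \<Rightarrow> 'a::idom"
  shows "2 * coeff (jacobi_poly d (Suc (Suc n))) n =
    (\<Sum>k=1..Suc (Suc n). d k)\<^sup>2 - (\<Sum>k=1..Suc (Suc n). (d k)\<^sup>2) - 2 * of_nat (Suc n)"
proof (induction n)
  case 0
  then show ?case by (simp add: algebra_simps power2_eq_square)
next
  case (Suc n)
  have "2 * coeff (jacobi_poly d (Suc (Suc (Suc n)))) (Suc n) =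
    2 * coeff (jacobi_poly d (Suc (Suc n))) n
    - 2 * d (Suc (Suc (Suc n))) * coeff (jacobi_poly d (Suc (Suc n))) (Suc n)
    - 2 * coeff (jacobi_poly d (Suc n)) (Suc n)"
    by (simp add: algebra_simps)
  also have "coeff (jacobi_poly d (Suc n)) (Suc n) = 1"
    using jacobi_poly_monic by blast
  also note coeff_jacobi_poly_1
  also note Suc
  finally show ?case
    by (simp add: algebra_simps power2_eq_square)
qed

lemma poly_jacobi_poly_of_real:
  "poly (jacobi_poly (\<lambda>k. of_real (d k)) n) (of_real x :: 'a::{real_algebra_1,comm_ring_1}) =
     of_real (poly (jacobi_poly d n) x)"
  by (induction n rule: induct_nat_012) simp_all

lemma poly_jacobi_poly_cnj:
  "poly (jacobi_poly (\<lambda>k. complex_of_real (d k)) n) (cnj z) =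
     cnj (poly (jacobi_poly (\<lambda>k. complex_of_real (d k)) n) z)"
  by (induction n rule: induct_nat_012) simp_all

text \<open>As \<open>d\<close> is real, \<open>cnj z\<close> is a root too, so the right side of
  Christoffel-Darboux vanishes. The sum on the left is positive since its summand at index 0 is
  1.\<close>

lemma jacobi_poly_root_real:
  assumes root: "poly (jacobi_poly (\<lambda>k. complex_of_real (d k)) (Suc n)) z = 0"
  shows "z \<in> \<real>"
proof -
  let ?p = "jacobi_poly (\<lambda>k. complex_of_real (d k))"
  have "(z - cnj z) * (\<Sum>k\<le>n. poly (?p k) z * poly (?p k) (cnj z)) = 0"
    using christoffel_darboux[of z "cnj z" "\<lambda>k. complex_of_real (d k)" n] root
    by (simp add: poly_jacobi_poly_cnj)
  moreover have "(\<Sum>k\<le>n. poly (?p k) z * poly (?p k) (cnj z)) =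
      complex_of_real (\<Sum>k\<le>n. (cmod (poly (?p k) z))\<^sup>2)"
    by (simp add: poly_jacobi_poly_cnj complex_norm_square del: of_real_power)
  moreover have "(\<Sum>k\<le>n. (cmod (poly (?p k) z))\<^sup>2) > 0"
    by (rule sum_pos2[of _ 0]) auto
  ultimately have "z - cnj z = 0"
    by (simp only: mult_eq_0_iff of_real_eq_0_iff) linarith
  then have "cnj z = z" by simp
  then show ?thesis by (simp add: Reals_cnj_iff)
qed

text \<open>At a multiple root the confluent identity would give 0 for a sum of squares. The root is
  real, so these squares are nonnegative, and the first is 1.\<close>

lemma rsquarefree_jacobi_poly:
  "rsquarefree (jacobi_poly (\<lambda>k. complex_of_real (d k)) (Suc n))"
proof -
  let ?p = "jacobi_poly (\<lambda>k. complex_of_real (d k))"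
  have "poly (pderiv (?p (Suc n))) z \<noteq> 0" if root: "poly (?p (Suc n)) z = 0" for z
  proof
    assume deriv: "poly (pderiv (?p (Suc n))) z = 0"
    obtain x where z: "z = of_real x"
      using jacobi_poly_root_real[OF root] by (auto elim: Reals_cases)
    have "complex_of_real (\<Sum>k\<le>n. (poly (jacobi_poly d k) x)\<^sup>2) = 0"
      using christoffel_darboux_confluent[of "\<lambda>k. complex_of_real (d k)" z n] root deriv
      by (simp add: z poly_jacobi_poly_of_real)
    moreover have "(\<Sum>k\<le>n. (poly (jacobi_poly d k) x)\<^sup>2) > 0"
      by (rule sum_pos2[of _ 0]) auto
    ultimately show False by (metis of_real_eq_0_iff less_irrefl)
  qed
  then show ?thesis by (auto simp: rsquarefree_roots)
qed

text \<open>A monic squarefree complex polynomial is the product of its linear factors over the root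
  set, and here that set consists of the real roots.\<close>

lemma jacobi_poly_eqI:
  assumes roots: "\<And>x. poly (jacobi_poly d (Suc n)) x = 0 \<longleftrightarrow> poly (jacobi_poly e (Suc n)) x = 0"
  shows "jacobi_poly (\<lambda>k. complex_of_real (d k)) (Suc n) =
         jacobi_poly (\<lambda>k. complex_of_real (e k)) (Suc n)"
proof -
  let ?p = "\<lambda>d. jacobi_poly (\<lambda>k. complex_of_real (d k)) (Suc n)"
  have root_set: "{z. poly (?p d) z = 0} = of_real ` {x. poly (jacobi_poly d (Suc n)) x = 0}" for d
    using jacobi_poly_root_real[of d n]
    by (fastforce elim: Reals_cases simp: poly_jacobi_poly_of_real simp del: jacobi_poly.simps)
  have factor: "?p d = (\<Prod>z | poly (?p d) z = 0. [:- z, 1:])" for d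
    using complex_poly_decompose_rsquarefree[OF rsquarefree_jacobi_poly[of d n]]
      jacobi_poly_monic[of "\<lambda>k. complex_of_real (d k)" "Suc n"]
    by (simp del: jacobi_poly.simps)
  show ?thesis
    by (subst (1 2) factor) (simp add: root_set roots del: jacobi_poly.simps)
qed

lemma sum_squares_eq_of_spectrum_eq:
  assumes n: "n \<ge> 2" and spec: "spectrum (schroedinger_mat n d) = spectrum (schroedinger_mat n e)"
  shows "(\<Sum>k=1..n. (d k)\<^sup>2) = (\<Sum>k=1..n. (e k)\<^sup>2)"
proof -
  obtain m where m: "n = Suc (Suc m)"
    using n by (metis add_2_eq_Suc le_Suc_ex)
  let ?d = "\<lambda>k. complex_of_real (d k)" and ?e = "\<lambda>k. complex_of_real (e k)"
  have eq: "jacobi_poly ?d n = jacobi_poly ?e n"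
    unfolding m
  proof (rule jacobi_poly_eqI)
    fix x
    have "eigenvalue (schroedinger_mat n d) x \<longleftrightarrow> eigenvalue (schroedinger_mat n e) x"
      using spec by (auto simp: spectrum_def)
    then show "poly (jacobi_poly d (Suc (Suc m))) x = 0 \<longleftrightarrow> poly (jacobi_poly e (Suc (Suc m))) x = 0"
      using n by (simp add: eigenvalue_schroedinger_mat_iff m del: jacobi_poly.simps)
  qed
  have s1: "(\<Sum>k=1..n. ?d k) = (\<Sum>k=1..n. ?e k)"
    using coeff_jacobi_poly_1[of ?d "Suc m"] coeff_jacobi_poly_1[of ?e "Suc m"] eq
    unfolding m by (metis neg_equal_iff_equal)
  \<comment> \<open>The off-diagonal constant depends on the size alone, and \<open>s1\<close>
    matches the squared sums, so only the sums of squares remain.\<close>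
  have "(\<Sum>k=1..n. (?d k)\<^sup>2) = (\<Sum>k=1..n. (?e k)\<^sup>2)"
    using coeff_jacobi_poly_2[of ?d m] coeff_jacobi_poly_2[of ?e m] eq s1
    unfolding m[symmetric] by (simp del: jacobi_poly.simps)
  then have "complex_of_real (\<Sum>k=1..n. (d k)\<^sup>2) = complex_of_real (\<Sum>k=1..n. (e k)\<^sup>2)"
    by simp
  then show ?thesis by (simp only: of_real_eq_iff)
qed

theorem theorem3p7:
  fixes n :: nat and b :: real and bs :: "nat \<Rightarrow> real"
  assumes "n \<ge> 2"
    and "spectrum (S_mat n b bs) = spectrum (F_mat n b)"
  shows "S_mat n b bs = F_mat n b \<and> (\<forall>k\<in>{2..n}. bs k = 0)"
proof -
  have split: "{1..n} = insert 1 {2..n}" using assms(1) by auto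
  have "(\<Sum>k=1..n. (if k = 1 then b else bs k)\<^sup>2) = (\<Sum>k=1..n. (if k = 1 then b else 0)\<^sup>2)"
    by (rule sum_squares_eq_of_spectrum_eq[OF assms(1) assms(2)[unfolded S_mat_def F_mat_def]])
  \<comment> \<open>The shared first entry contributes the square of \<open>b\<close> to both sides
    and cancels.\<close>
  then have "(\<Sum>k=2..n. (if k = 1 then b else bs k)\<^sup>2) = (\<Sum>k=2..n. (if k = 1 then b else 0)\<^sup>2)"
    unfolding split by simp
  also have "\<dots> = 0" by (intro sum.neutral) auto
  finally have zero: "\<forall>k\<in>{2..n}. bs k = 0"
    by (subst (asm) sum_nonneg_eq_0_iff) auto
  then have "S_mat n b bs = F_mat n b"
    by (intro eq_matI) (auto simp: S_mat_def F_mat_def schroedinger_mat_def)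
  with zero show ?thesis by blast
qed

end
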